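(* Let $d_1,d_3,\beta_1,\beta_3,\kappa_1,\kappa_2>0$, $\alpha_1,\alpha_4>0$, $\alpha_3\ge 0$ be constants, let $\alpha_2=0$, assume $\alpha_3\neq 6$, $\alpha_3\neq 8$, $\alpha_3\neq 40d_1$, $40d_1+6\alpha_1-\alpha_3\neq 0$, and suppose that $$\beta_1=-16d_1+\alpha_3,\quad \beta_3=\frac{2\alpha_1\alpha_3[\alpha_3-2(4+\alpha_4)]}{(\alpha_3-8)(40d_1+6\alpha_1-\alpha_3)},\quad d_3=\frac{\alpha_3-2\alpha_4-2\beta_3}{8},$$ $$\kappa_1=\frac{\alpha_1(\alpha_3-24)(\alpha_3-6)}{\alpha_4(\alpha_3-8)(\alpha_3-40d_1)},\quad \kappa_2=\frac{\alpha_3(6-\alpha_3+2\alpha_4)}{\alpha_1(\alpha_3-6)}\kappa_1.$$ Then the functions $$u(t,x)=\frac14\left(1-\tanh\left(x-\tfrac{\alpha_3}{4}t\right)\right)^2,\quad v(t,x)=1+\frac{24-\alpha_3}{2(\alpha_3-8)}\left(1-\tanh^2\left(x-\tfrac{\alpha_3}{4}t\right)\right),$$ $$w(t,x)=\frac{\alpha_3-40d_1}{4\alpha_1}\left(1-\tanh^2\left(x-\tfrac{\alpha_3}{4}t\right)\right)$$ form an exact solution, for all $(t,x)\in\mathbb{R}^2$, of the system $$u_t = d_1u_{xx}+\beta_1u(1-u)-\alpha_1uw+\alpha_2uv,$$ $$v_t = v_{xx}+ v(1-v)+(\kappa_1\alpha_3+\kappa_2\alpha_1)uw-(\kappa_2\alpha_2u+\kappa_1\alpha_4w)v,$$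 $$w_t = d_3 w_{xx}+\beta_3w(1-w)-\alpha_3uw+\alpha_4vw.$$ *)

theory Defs
  imports "HOL-Analysis.Analysis"
begin

text \<open>Functions of time and one space variable are curried: \<open>f t x\<close>.\<close>

definition pd_t :: "(real \<Rightarrow> real \<Rightarrow> real) \<Rightarrow> real \<Rightarrow> real \<Rightarrow> real" where
  "pd_t f t x = deriv (\<lambda>s. f s x) t"

definition pd_x :: "(real \<Rightarrow> real \<Rightarrow> real) \<Rightarrow> real \<Rightarrow> real \<Rightarrow> real" where
  "pd_x f t x = deriv (\<lambda>y. f t y) x"

definition pd_xx :: "(real \<Rightarrow> real \<Rightarrow> real) \<Rightarrow> real \<Rightarrow> real \<Rightarrow> real" where
  "pd_xx f = pd_x (pd_x f)"

text \<open>The class $C^{1,2}(\mathbb{R}^2)$. Since \<^const>\<open>deriv\<close> is total, the existence of the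
  derivatives has to be demanded separately.\<close>

definition C12 :: "(real \<Rightarrow> real \<Rightarrow> real) \<Rightarrow> bool" where
  "C12 f \<longleftrightarrow>
     (\<forall>t x. (\<lambda>s. f s x) field_differentiable (at t)
          \<and> (\<lambda>y. f t y) field_differentiable (at x)
          \<and> (\<lambda>y. pd_x f t y) field_differentiable (at x))
   \<and> continuous_on UNIV (\<lambda>(t, x). f t x)
   \<and> continuous_on UNIV (\<lambda>(t, x). pd_t f t x)
   \<and> continuous_on UNIV (\<lambda>(t, x). pd_x f t x)
   \<and> continuous_on UNIV (\<lambda>(t, x). pd_xx f t x)"

text \<open>Classical solutions on all of $\mathbb{R}^2$. The diffusion coefficient and the growth rate
  of the second species are normalised to 1.\<close>

definition is_solution ::
  "real \<Rightarrow> real \<Rightarrow> real \<Rightarrow> real \<Rightarrow> real \<Rightarrow> real \<Rightarrow> real \<Rightarrow> real \<Rightarrow> real \<Rightarrow> real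
   \<Rightarrow> (real \<Rightarrow> real \<Rightarrow> real) \<Rightarrow> (real \<Rightarrow> real \<Rightarrow> real) \<Rightarrow> (real \<Rightarrow> real \<Rightarrow> real) \<Rightarrow> bool" where
  "is_solution d\<^sub>1 d\<^sub>3 \<beta>\<^sub>1 \<beta>\<^sub>3 \<kappa>\<^sub>1 \<kappa>\<^sub>2 \<alpha>\<^sub>1 \<alpha>\<^sub>2 \<alpha>\<^sub>3 \<alpha>\<^sub>4 u v w \<longleftrightarrow>
     C12 u \<and> C12 v \<and> C12 w \<and>
     (\<forall>t x.
        pd_t u t x = d\<^sub>1 * pd_xx u t x + \<beta>\<^sub>1 * u t x * (1 - u t x)
                     - \<alpha>\<^sub>1 * u t x * w t x + \<alpha>\<^sub>2 * u t x * v t x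
      \<and> pd_t v t x = pd_xx v t x + v t x * (1 - v t x)
                     + (\<kappa>\<^sub>1 * \<alpha>\<^sub>3 + \<kappa>\<^sub>2 * \<alpha>\<^sub>1) * u t x * w t x
                     - (\<kappa>\<^sub>2 * \<alpha>\<^sub>2 * u t x + \<kappa>\<^sub>1 * \<alpha>\<^sub>4 * w t x) * v t x
      \<and> pd_t w t x = d\<^sub>3 * pd_xx w t x + \<beta>\<^sub>3 * w t x * (1 - w t x)
                     - \<alpha>\<^sub>3 * u t x * w t x + \<alpha>\<^sub>4 * v t x * w t x)"

end

(* Along the wave variable z = x - c t with T = tanh z one has T' = 1 - T^2, so that each equation
   becomes a polynomial identity in T. After division by (1 - T)^2 (1 + T) in the first equation and
   by 1 - T^2 in the other two, the relations among the parameters make the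
   coefficient of every power of T vanish. *)

theory Submission
  imports Defs
begin

text \<open>With \<open>F'\<close> and \<open>F''\<close> given explicitly, every
  \<open>deriv\<close> is computed by the chain rule along z = x - c t. For \<open>C12\<close>,
  differentiability makes \<open>F\<close> and \<open>F'\<close> continuous, so continuity has to be
  supplied for \<open>F''\<close> alone.\<close>

lemma
  fixes F F' F'' :: "real \<Rightarrow> real" and c :: real
  assumes F: "\<And>z. (F has_field_derivative F' z) (at z)"
    and F': "\<And>z. (F' has_field_derivative F'' z) (at z)"
  shows pd_t_travelling_wave: "pd_t (\<lambda>t x. F (x - c * t)) = (\<lambda>t x. - c * F' (x - c * t))"
    and pd_xx_travelling_wave: "pd_xx (\<lambda>t x. F (x - c * t)) = (\<lambda>t x. F'' (x - c * t))"
    and C12_travelling_wave: "continuous_on UNIV F'' \<Longrightarrow> C12 (\<lambda>t x. F (x - c * t))"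
proof -
  have dt: "((\<lambda>s. F (x - c * s)) has_field_derivative - c * F' (x - c * t)) (at t)" for t x
    by (rule DERIV_cong[OF DERIV_chain2[OF F]]) (auto intro!: derivative_eq_intros)
  have dx: "((\<lambda>y. F (y - c * t)) has_field_derivative F' (x - c * t)) (at x)" for t x
    by (rule DERIV_cong[OF DERIV_chain2[OF F]]) (auto intro!: derivative_eq_intros)
  have dxx: "((\<lambda>y. F' (y - c * t)) has_field_derivative F'' (x - c * t)) (at x)" for t x
    by (rule DERIV_cong[OF DERIV_chain2[OF F']]) (auto intro!: derivative_eq_intros)
  show pt: "pd_t (\<lambda>t x. F (x - c * t)) = (\<lambda>t x. - c * F' (x - c * t))"
    by (intro ext) (simp add: pd_t_def DERIV_imp_deriv[OF dt])
  have px: "pd_x (\<lambda>t x. F (x - c * t)) = (\<lambda>t x. F' (x - c * t))"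
    by (intro ext) (simp add: pd_x_def DERIV_imp_deriv[OF dx])
  show pxx: "pd_xx (\<lambda>t x. F (x - c * t)) = (\<lambda>t x. F'' (x - c * t))"
    unfolding pd_xx_def px by (intro ext) (simp add: pd_x_def DERIV_imp_deriv[OF dxx])
  assume cont'': "continuous_on UNIV F''"
  have cont: "continuous_on UNIV F" "continuous_on UNIV F'"
    using F F' by (meson DERIV_isCont continuous_at_imp_continuous_on)+
  have comp: "continuous_on UNIV (\<lambda>p. G (snd p - c * fst p))"
    if "continuous_on UNIV G" for G :: "real \<Rightarrow> real"
    by (rule continuous_on_compose2[OF that]) (auto intro!: continuous_intros)
  show "C12 (\<lambda>t x. F (x - c * t))"
    unfolding C12_def pt px pxx case_prod_beta field_differentiable_def
  proof (intro conjI allI)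
    show "continuous_on UNIV (\<lambda>p. - c * F' (snd p - c * fst p))"
      by (intro continuous_intros comp cont)
  qed ((rule exI, rule dt dx dxx) | (rule comp, fact))+
qed

text \<open>Since (1 - T)' = -(1 - T)(1 + T), both derivatives keep the factor (1 - T)^2 (1 + T).
  The logistic term shares it because 1 - u = (1 + T)(3 - T)/4.\<close>

lemma has_field_derivative_kink:
  fixes z :: real
  shows "((\<lambda>z. 1 / 4 * (1 - tanh z) ^ 2) has_field_derivative
      - ((1 - tanh z) ^ 2 * (1 + tanh z)) / 2) (at z)"
    and "((\<lambda>z. - ((1 - tanh z) ^ 2 * (1 + tanh z)) / 2) has_field_derivative
      (1 - tanh z) ^ 2 * (1 + tanh z) * (1 + 3 * tanh z) / 2) (at z)"
  by (auto intro!: derivative_eq_intros) algebra+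

text \<open>One profile serves both v (offset 1) and w (offset 0); the factor 1 - T^2 survives
  differentiation.\<close>

lemma has_field_derivative_pulse:
  fixes a b z :: real
  shows "((\<lambda>z. a + b * (1 - tanh z ^ 2)) has_field_derivative
      - 2 * b * tanh z * (1 - tanh z ^ 2)) (at z)"
    and "((\<lambda>z. - 2 * b * tanh z * (1 - tanh z ^ 2)) has_field_derivative
      b * (1 - tanh z ^ 2) * (6 * tanh z ^ 2 - 2)) (at z)"
  by (auto intro!: derivative_eq_intros) algebra+

theorem mainTheorem5:
  fixes d\<^sub>1 d\<^sub>3 \<beta>\<^sub>1 \<beta>\<^sub>3 \<kappa>\<^sub>1 \<kappa>\<^sub>2 \<alpha>\<^sub>1 \<alpha>\<^sub>2 \<alpha>\<^sub>3 \<alpha>\<^sub>4 :: real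
    and u v w :: "real \<Rightarrow> real \<Rightarrow> real"
  assumes "d\<^sub>1 > 0" "d\<^sub>3 > 0" "\<beta>\<^sub>1 > 0" "\<beta>\<^sub>3 > 0" "\<kappa>\<^sub>1 > 0" "\<kappa>\<^sub>2 > 0"
    and "\<alpha>\<^sub>1 > 0" "\<alpha>\<^sub>4 > 0" "\<alpha>\<^sub>3 \<ge> 0" "\<alpha>\<^sub>2 = 0"
    and "\<alpha>\<^sub>3 \<noteq> 6" "\<alpha>\<^sub>3 \<noteq> 8" "\<alpha>\<^sub>3 \<noteq> 40 * d\<^sub>1" "40 * d\<^sub>1 + 6 * \<alpha>\<^sub>1 - \<alpha>\<^sub>3 \<noteq> 0"
    and "\<beta>\<^sub>1 = - 16 * d\<^sub>1 + \<alpha>\<^sub>3"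
    and "\<beta>\<^sub>3 = (2 * \<alpha>\<^sub>1 * \<alpha>\<^sub>3 * (\<alpha>\<^sub>3 - 2 * (4 + \<alpha>\<^sub>4)))
              / ((\<alpha>\<^sub>3 - 8) * (40 * d\<^sub>1 + 6 * \<alpha>\<^sub>1 - \<alpha>\<^sub>3))"
    and "d\<^sub>3 = (\<alpha>\<^sub>3 - 2 * \<alpha>\<^sub>4 - 2 * \<beta>\<^sub>3) / 8"
    and "\<kappa>\<^sub>1 = (\<alpha>\<^sub>1 * (\<alpha>\<^sub>3 - 24) * (\<alpha>\<^sub>3 - 6)) / (\<alpha>\<^sub>4 * (\<alpha>\<^sub>3 - 8) * (\<alpha>\<^sub>3 - 40 * d\<^sub>1))"
    and "\<kappa>\<^sub>2 = (\<alpha>\<^sub>3 * (6 - \<alpha>\<^sub>3 + 2 * \<alpha>\<^sub>4)) / (\<alpha>\<^sub>1 * (\<alpha>\<^sub>3 - 6)) * \<kappa>\<^sub>1"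
    and "\<And>t x. u t x = 1 / 4 * (1 - tanh (x - \<alpha>\<^sub>3 / 4 * t)) ^ 2"
    and "\<And>t x. v t x = 1 + (24 - \<alpha>\<^sub>3) / (2 * (\<alpha>\<^sub>3 - 8)) * (1 - tanh (x - \<alpha>\<^sub>3 / 4 * t) ^ 2)"
    and "\<And>t x. w t x = (\<alpha>\<^sub>3 - 40 * d\<^sub>1) / (4 * \<alpha>\<^sub>1) * (1 - tanh (x - \<alpha>\<^sub>3 / 4 * t) ^ 2)"
  shows "is_solution d\<^sub>1 d\<^sub>3 \<beta>\<^sub>1 \<beta>\<^sub>3 \<kappa>\<^sub>1 \<kappa>\<^sub>2 \<alpha>\<^sub>1 \<alpha>\<^sub>2 \<alpha>\<^sub>3 \<alpha>\<^sub>4 u v w"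
proof -
  define c where "c = \<alpha>\<^sub>3 / 4"
  define A where "A = (24 - \<alpha>\<^sub>3) / (2 * (\<alpha>\<^sub>3 - 8))"
  define B where "B = (\<alpha>\<^sub>3 - 40 * d\<^sub>1) / (4 * \<alpha>\<^sub>1)"
  have u: "u = (\<lambda>t x. 1 / 4 * (1 - tanh (x - c * t)) ^ 2)"
    and v: "v = (\<lambda>t x. 1 + A * (1 - tanh (x - c * t) ^ 2))"
    \<comment> \<open>The summand 0 makes w an instance of the pulse profile.\<close>
    and w: "w = (\<lambda>t x. 0 + B * (1 - tanh (x - c * t) ^ 2))"
    unfolding fun_eq_iff assms(20-22) c_def A_def B_def by simp_all
  note u_wave = has_field_derivative_kink
  note v_wave = has_field_derivative_pulse(1)[of 1 A] has_field_derivative_pulse(2)[of A]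
  note w_wave = has_field_derivative_pulse(1)[of 0 B] has_field_derivative_pulse(2)[of B]
  have "C12 u" "C12 v" "C12 w"
    unfolding u v w
    by (rule C12_travelling_wave[OF u_wave] C12_travelling_wave[OF v_wave]
          C12_travelling_wave[OF w_wave]; intro continuous_intros; simp)+
  \<comment> \<open>Folding back to \<open>u\<close> lets these facts rewrite the derivatives in the
    equations before \<open>u\<close> itself is unfolded; likewise for \<open>v\<close> and
    \<open>w\<close>.\<close>
  note u_derivs = pd_t_travelling_wave[OF u_wave, of c, folded u]
    pd_xx_travelling_wave[OF u_wave, of c, folded u]
  note v_derivs = pd_t_travelling_wave[OF v_wave, of c, folded v]
    pd_xx_travelling_wave[OF v_wave, of c, folded v]
  note w_derivs = pd_t_travelling_wave[OF w_wave, of c, folded w]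
    pd_xx_travelling_wave[OF w_wave, of c, folded w]
  \<comment> \<open>After division by S = 1 - T^2, the uw-term of the second equation is K (1 - T)^2
    and the wv-term is M v.\<close>
  define K where "K = (\<kappa>\<^sub>1 * \<alpha>\<^sub>3 + \<kappa>\<^sub>2 * \<alpha>\<^sub>1) * B / 4"
  define M where "M = \<kappa>\<^sub>1 * \<alpha>\<^sub>4 * B"
  have A: "2 * A * (\<alpha>\<^sub>3 - 8) = 24 - \<alpha>\<^sub>3"
    using assms(12) by (simp add: A_def field_simps)
  have B: "4 * \<alpha>\<^sub>1 * B = \<alpha>\<^sub>3 - 40 * d\<^sub>1"
    using assms(7) by (simp add: B_def field_simps)
  \<comment> \<open>The factor \<open>\<alpha>\<^sub>3 - 40 * d\<^sub>1\<close> of B cancels against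
    the denominator of \<open>\<kappa>\<^sub>1\<close>.\<close>
  have M: "2 * M = - A * (\<alpha>\<^sub>3 - 6)"
  proof -
    have "\<alpha>\<^sub>3 - 40 * d\<^sub>1 \<noteq> 0" "\<alpha>\<^sub>3 - 8 \<noteq> 0" "\<alpha>\<^sub>4 \<noteq> 0" "\<alpha>\<^sub>1 \<noteq> 0"
      using assms(7,8,12,13) by auto
    then show ?thesis
      unfolding M_def B_def A_def assms(18) by (simp add: divide_simps) algebra
  qed
  \<comment> \<open>The choice of \<open>\<kappa>\<^sub>2\<close> turns the uw-coefficient, times
    \<open>\<alpha>\<^sub>3 - 6\<close>, into a multiple of
    \<open>\<kappa>\<^sub>1 * \<alpha>\<^sub>4\<close>, which links K to M.\<close>
  have K: "4 * K = - \<alpha>\<^sub>3 * A"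
  proof -
    have "\<alpha>\<^sub>3 - 6 \<noteq> 0" "\<alpha>\<^sub>1 \<noteq> 0"
      using assms(7,11) by auto
    then have "\<kappa>\<^sub>2 * \<alpha>\<^sub>1 * (\<alpha>\<^sub>3 - 6) = \<alpha>\<^sub>3 * (6 - \<alpha>\<^sub>3 + 2 * \<alpha>\<^sub>4) * \<kappa>\<^sub>1"
      unfolding assms(19) by simp
    then have "(\<kappa>\<^sub>1 * \<alpha>\<^sub>3 + \<kappa>\<^sub>2 * \<alpha>\<^sub>1) * (\<alpha>\<^sub>3 - 6) = 2 * \<kappa>\<^sub>1 * \<alpha>\<^sub>3 * \<alpha>\<^sub>4"
      by algebra
    then have "(\<alpha>\<^sub>3 - 6) * (4 * K) = \<alpha>\<^sub>3 * (2 * M)"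
      unfolding K_def M_def by algebra
    then have "(\<alpha>\<^sub>3 - 6) * (4 * K) = (\<alpha>\<^sub>3 - 6) * (- \<alpha>\<^sub>3 * A)"
      unfolding M by algebra
    with \<open>\<alpha>\<^sub>3 - 6 \<noteq> 0\<close> show ?thesis
      using mult_left_cancel by blast
  qed
  have d3: "8 * d\<^sub>3 = \<alpha>\<^sub>3 - 2 * \<alpha>\<^sub>4 - 2 * \<beta>\<^sub>3"
    using assms(17) by simp
  \<comment> \<open>By \<open>B\<close>, the last factor in the denominator of
    \<open>\<beta>\<^sub>3\<close> is \<open>- 2 * \<alpha>\<^sub>1 * (2 * B - 3)\<close>. The
    result is the T^2 coefficient of the third equation after elimination of
    \<open>d\<^sub>3\<close>.\<close>
  have \<beta>3: "\<beta>\<^sub>3 * (2 * B - 3) = - \<alpha>\<^sub>3 + \<alpha>\<^sub>4 * (3 + 2 * A)"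
  proof -
    have nz: "40 * d\<^sub>1 + 6 * \<alpha>\<^sub>1 - \<alpha>\<^sub>3 \<noteq> 0" "\<alpha>\<^sub>3 - 8 \<noteq> 0" "\<alpha>\<^sub>1 \<noteq> 0"
      using assms(7,12,14) by auto
    have "\<beta>\<^sub>3 * ((\<alpha>\<^sub>3 - 8) * (40 * d\<^sub>1 + 6 * \<alpha>\<^sub>1 - \<alpha>\<^sub>3)) = 2 * \<alpha>\<^sub>1 * \<alpha>\<^sub>3 * (\<alpha>\<^sub>3 - 2 * (4 + \<alpha>\<^sub>4))"
      using nz unfolding assms(16) by simp
    then have "2 * \<alpha>\<^sub>1 * (\<alpha>\<^sub>3 - 8) * (\<beta>\<^sub>3 * (2 * B - 3))
        = 2 * \<alpha>\<^sub>1 * (\<alpha>\<^sub>3 - 8) * (- \<alpha>\<^sub>3 + \<alpha>\<^sub>4 * (3 + 2 * A))"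
      using A B by algebra
    moreover have "2 * \<alpha>\<^sub>1 * (\<alpha>\<^sub>3 - 8) \<noteq> 0"
      using nz by simp
    ultimately show ?thesis
      using mult_left_cancel by blast
  qed
  have "pd_t u t x = d\<^sub>1 * pd_xx u t x + \<beta>\<^sub>1 * u t x * (1 - u t x)
      - \<alpha>\<^sub>1 * u t x * w t x + \<alpha>\<^sub>2 * u t x * v t x" for t x
  proof -
    define T where "T = tanh (x - c * t)"
    \<comment> \<open>Without the common factor both sides are linear in T: the T coefficient
      vanishes by \<open>4 * \<alpha>\<^sub>1 * B = \<alpha>\<^sub>3 - 40 * d\<^sub>1\<close>, and
      the constant one then gives the speed c.\<close>
    have "c * ((1 - T)\<^sup>2 * (1 + T)) / 2 = d\<^sub>1 * ((1 - T)\<^sup>2 * (1 + T) * (1 + 3 * T) / 2)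
        + \<beta>\<^sub>1 * ((1 - T)\<^sup>2 / 4) * (1 - (1 - T)\<^sup>2 / 4) - (1 - T)\<^sup>2 / 4 * (\<alpha>\<^sub>1 * B) * (1 - T\<^sup>2)"
    proof -
      have "\<alpha>\<^sub>1 * B = (\<alpha>\<^sub>3 - 40 * d\<^sub>1) / 4"
        using B by simp
      then show ?thesis
        unfolding c_def assms(15) by (simp add: divide_simps) algebra
    qed
    then show ?thesis
      unfolding u_derivs unfolding u v w T_def[symmetric] \<open>\<alpha>\<^sub>2 = 0\<close>
      by (simp add: algebra_simps)
  qed
  moreover have "pd_t v t x = pd_xx v t x + v t x * (1 - v t x)
      + (\<kappa>\<^sub>1 * \<alpha>\<^sub>3 + \<kappa>\<^sub>2 * \<alpha>\<^sub>1) * u t x * w t x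
      - (\<kappa>\<^sub>2 * \<alpha>\<^sub>2 * u t x + \<kappa>\<^sub>1 * \<alpha>\<^sub>4 * w t x) * v t x" for t x
  proof -
    define T where "T = tanh (x - c * t)"
    define S where "S = 1 - T\<^sup>2"
    \<comment> \<open>The T coefficient is the relation \<open>K\<close>. With K and M expressed
      through A, the T^2 and constant coefficients both reduce to multiples of the relation
      \<open>A\<close>.\<close>
    have "2 * c * A * T = A * (6 * T\<^sup>2 - 2) - (1 + A * S) * A + K * (1 - T)\<^sup>2 - M * (1 + A * S)"
    proof -
      have "K = - \<alpha>\<^sub>3 * A / 4" "M = - A * (\<alpha>\<^sub>3 - 6) / 2"
        using K M by auto
      then show ?thesis
        using A unfolding c_def S_def by (simp add: divide_simps) algebra
    qed
    \<comment> \<open>Multiplying the reduced identity by S restores the equation, so nothing is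
      divided by S.\<close>
    then have "2 * c * A * T * S
        = (A * (6 * T\<^sup>2 - 2) - (1 + A * S) * A + K * (1 - T)\<^sup>2 - M * (1 + A * S)) * S"
      by simp
    then show ?thesis
      unfolding v_derivs unfolding u v w T_def[symmetric] S_def[symmetric] K_def M_def \<open>\<alpha>\<^sub>2 = 0\<close>
      by (simp add: algebra_simps)
  qed
  moreover have "pd_t w t x = d\<^sub>3 * pd_xx w t x + \<beta>\<^sub>3 * w t x * (1 - w t x)
      - \<alpha>\<^sub>3 * u t x * w t x + \<alpha>\<^sub>4 * v t x * w t x" for t x
  proof -
    define T where "T = tanh (x - c * t)"
    define S where "S = 1 - T\<^sup>2"
    \<comment> \<open>The T coefficients agree by the choice of c. The T^2 and constant coefficients
      sum to the relation \<open>d3\<close>; what remains is \<open>\<beta>3\<close>.\<close>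
    have "2 * c * T = d\<^sub>3 * (6 * T\<^sup>2 - 2) + \<beta>\<^sub>3 * (1 - B * S) - \<alpha>\<^sub>3 * (1 - T)\<^sup>2 / 4
        + \<alpha>\<^sub>4 * (1 + A * S)"
      using d3 \<beta>3 unfolding c_def S_def by (simp add: divide_simps) algebra
    then have "2 * c * T * (B * S) = (d\<^sub>3 * (6 * T\<^sup>2 - 2) + \<beta>\<^sub>3 * (1 - B * S)
        - \<alpha>\<^sub>3 * (1 - T)\<^sup>2 / 4 + \<alpha>\<^sub>4 * (1 + A * S)) * (B * S)"
      by simp
    then show ?thesis
      unfolding w_derivs unfolding u v w T_def[symmetric] S_def[symmetric]
      by (simp add: algebra_simps)
  qed
  ultimately show ?thesis
    using \<open>C12 u\<close> \<open>C12 v\<close> \<open>C12 w\<close> unfolding is_solution_def by blast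
qed

end
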